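(* Let $n \geq 1$ and let $K$ be a field in which every polynomial of degree $n$ (with coefficients in $K$) has a root. The linear maps $M_n(K) \to M_n(K)$ preserving the $\mathcal{R}$ relation are precisely those of the form $A \mapsto XAP$, where $P \in GL_n(K)$ and $X \in M_n(K)$.
   Context: $M_n(K)$ is the set of $n \times n$ matrices over $K$, viewed as a $K$-vector space and as a monoid under multiplication; $GL_n(K)$ is its group of invertible matrices. Green's relation $\mathcal{R}$ on $M_n(K)$: $A\,\mathcal{R}\,B$ if there exist $X, Y \in M_n(K)$ with $A = BX$ and $B = AY$. A map $T$ preserves $\mathcal{R}$ if $A\,\mathcal{R}\,B$ implies $T(A)\,\mathcal{R}\,T(B)$ for all $A, B \in M_n(K)$. *)

theory Defs
  imports "HOL-Analysis.Analysis" "HOL-Computational_Algebra.Polynomial"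
begin

text \<open>
  The library provides scalar multiplication \<open>*s\<close> on vectors over an arbitrary field, but on
  matrices only the real one; here a scalar acts on a matrix row by row.
\<close>

definition mat_scale :: "'k::field \<Rightarrow> 'k^'m^'n \<Rightarrow> 'k^'m^'n" where
  "mat_scale c A = (\<chi> i. c *s (A $ i))"

lemma mat_scale_nth [simp]: "mat_scale c A $ i $ j = c * A $ i $ j"
  by (simp add: mat_scale_def)

lemma vector_space_mat_scale: "vector_space (mat_scale :: 'k::field \<Rightarrow> 'k^'m^'n \<Rightarrow> 'k^'m^'n)"
  by unfold_locales (simp_all add: vec_eq_iff algebra_simps)

text \<open>
  The relation is taken with respect to matrix multiplication \<open>**\<close>; the class operation \<open>*\<close> on
  the type of matrices is the entrywise product.
\<close>

definition green_R :: "'k::field^'n^'n \<Rightarrow> 'k^'n^'n \<Rightarrow> bool" where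
  "green_R A B \<longleftrightarrow> (\<exists>X Y. A = B ** X \<and> B = A ** Y)"

definition preserves_R :: "('k::field^'n^'n \<Rightarrow> 'k^'n^'n) \<Rightarrow> bool" where
  "preserves_R T \<longleftrightarrow> (\<forall>A B. green_R A B \<longrightarrow> green_R (T A) (T B))"

end

theory Submission imports Defs
begin

text \<open>
  For a row vector \<open>\<phi>\<close> and a column vector \<open>u\<close> let \<open>G \<phi> u\<close> be the matrix of the map
  \<open>w \<mapsto> \<phi> T(u w\<^sup>T)\<close>. Since all \<open>u w\<^sup>T\<close> with \<open>w \<noteq> 0\<close> lie in one \<open>\<R>\<close>-class, \<open>G \<phi> u\<close> is either zero
  or invertible. If \<open>N = G \<phi> u\<close> is invertible and \<open>M = G \<psi> u\<close> or \<open>M = G \<phi> v\<close>, then \<open>N\<^sup>-\<^sup>1 M\<close> has an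
  eigenvalue \<open>c\<close>, because its characteristic polynomial has degree \<open>n\<close>; hence \<open>M - c N\<close>, which is
  again of the form \<open>G \<phi>' u'\<close>, is singular and so vanishes. For \<open>G \<phi> u\<close> and
  \<open>G \<psi> v\<close> with \<open>G \<psi> u = G \<phi> v = 0\<close> use \<open>\<phi> + \<psi>\<close> as the common row. Unless \<open>T = 0\<close>, all \<open>G \<phi> u\<close>
  are thus scalar multiples of a single invertible \<open>L\<close>, and reading off the scalars gives \<open>X\<close> with \<open>T A = X A L\<^sup>T\<close>.
\<close>

section \<open>Characteristic polynomials and eigenvectors\<close>

lemma sign_poly_cases:
  obtains "of_int (sign p) = (1::'a::comm_ring_1)" "of_int (sign p) = (1::'a poly)"
  | "of_int (sign p) = (-1::'a)" "of_int (sign p) = (-1::'a poly)"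
  by (cases "sign p = 1") (auto simp: sign_def split: if_splits)

lemma poly_det:
  fixes M :: "'a::comm_ring_1 poly^'n^'n"
  shows "poly (det M) x = det (\<chi> i j. poly (M $ i $ j) x)"
proof -
  \<comment> \<open>The sign occurs both as a constant polynomial and as a scalar; fixing its value
    as 1 or -1 settles both at once.\<close>
  have "poly (of_int (sign p) * (\<Prod>i\<in>UNIV. M $ i $ p i)) x
      = of_int (sign p) * (\<Prod>i\<in>UNIV. poly (M $ i $ p i) x)" for p
    by (rule sign_poly_cases[of p, where 'a='a]) (simp_all add: poly_prod)
  then show ?thesis
    by (simp add: det_def poly_sum)
qed

definition char_matrix :: "'a::idom^'n^'n \<Rightarrow> 'a poly^'n^'n" where
  "char_matrix A = (\<chi> i j. if i = j then [:- A $ i $ j, 1:] else [:- A $ i $ j:])"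

text \<open>In the Leibniz expansion only the identity takes all the linear diagonal entries. Any
  other permutation meets a constant off-diagonal entry, so its term cannot cancel the leading
  one.\<close>

lemma degree_det_char_matrix:
  fixes A :: "'a::idom^'n^'n"
  shows "degree (det (char_matrix A)) = CARD('n)"
proof -
  let ?M = "char_matrix A"
  let ?t = "\<lambda>p. of_int (sign p) * (\<Prod>i\<in>UNIV. ?M $ i $ p i) :: 'a poly"
  let ?S = "{p. p permutes (UNIV :: 'n set)}"
  have deg_t: "degree (?t p) = degree (\<Prod>i\<in>UNIV. ?M $ i $ p i)" for p
    by (rule sign_poly_cases[of p, where 'a='a]) simp_all
  have id: "degree (?t id) = CARD('n)"
  proof -
    have "degree (\<Prod>i\<in>UNIV. ?M $ i $ i) = (\<Sum>i\<in>UNIV. degree (?M $ i $ i))"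
      by (rule degree_prod_eq_sum_degree) (simp add: char_matrix_def)
    also have "\<dots> = CARD('n)"
      by (simp add: char_matrix_def)
    finally show ?thesis
      by (simp add: deg_t)
  qed
  have less: "degree (?t p) < CARD('n)" if "p \<in> ?S - {id}" for p
  proof -
    have "p \<noteq> id"
      using that by simp
    then obtain i where i: "p i \<noteq> i"
      unfolding fun_eq_iff by auto
    have "degree (?t p) \<le> (\<Sum>i\<in>UNIV. degree (?M $ i $ p i))"
      unfolding deg_t using degree_prod_sum_le[of UNIV "\<lambda>i. ?M $ i $ p i"] by (simp add: o_def)
    also have "\<dots> < (\<Sum>i\<in>(UNIV :: 'n set). 1)"
      by (rule sum_strict_mono_ex1) (use i in \<open>auto simp: char_matrix_def intro: exI[of _ i]\<close>)
    finally show ?thesis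
      by simp
  qed
  have "degree (\<Sum>p\<in>?S - {id}. ?t p) < CARD('n)"
    by (rule degree_sum_less) (use less in auto)
  moreover have "det ?M = ?t id + (\<Sum>p\<in>?S - {id}. ?t p)"
    unfolding det_def by (rule sum.remove) (auto simp: finite_permutations permutes_id)
  ultimately show ?thesis
    using id by (simp add: degree_add_eq_left)
qed

text \<open>Evaluating \<open>char_matrix A\<close> at a root \<open>c\<close> of its determinant
  gives the singular matrix \<open>mat c - A\<close>, whose kernel consists of eigenvectors.\<close>

lemma eigenvector_exists:
  fixes A :: "'k::field^'n^'n"
  assumes root: "\<And>p :: 'k poly. degree p = CARD('n) \<Longrightarrow> \<exists>x. poly p x = 0"
  obtains c w where "w \<noteq> 0" "A *v w = c *s w"
proof -
  obtain c where c: "poly (det (char_matrix A)) c = 0"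
    using root degree_det_char_matrix by blast
  have "(\<chi> i j. poly (char_matrix A $ i $ j) c) = mat c - A"
    by (simp add: vec_eq_iff char_matrix_def mat_def)
  with c have "det (mat c - A) = 0"
    by (simp add: poly_det)
  then obtain w where "w \<noteq> 0" "(mat c - A) *v w = 0"
    by (metis invertible_det_nz invertible_left_inverse matrix_left_invertible_ker)
  moreover have "mat c *v w = c *s w"
    by (simp add: vec_eq_iff matrix_vector_mult_def mat_def if_distrib[of "\<lambda>x. x * _"] cong: if_cong)
  ultimately show thesis
    using that[of w c] by (simp add: matrix_vector_mult_diff_rdistrib)
qed

lemma mat_scale_matrix_vector_mult: "mat_scale c A *v w = c *s (A *v w)"
  by (simp add: vec_eq_iff matrix_vector_mult_def sum_distrib_left mult.assoc)

text \<open>The assumption \<open>pencil\<close> abstracts the zero-or-invertible dichotomy, so that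
  one argument serves for varying \<phi> with \<open>u\<close> fixed and for varying
  \<open>u\<close> with \<phi> fixed.\<close>

lemma scalar_multiple_if_pencil_zero_or_injective:
  fixes M N :: "'k::field^'n^'n"
  assumes root: "\<And>p :: 'k poly. degree p = CARD('n) \<Longrightarrow> \<exists>x. poly p x = 0"
    and N: "invertible N"
    and pencil: "\<And>c w. w \<noteq> 0 \<Longrightarrow> (M - mat_scale c N) *v w = 0 \<Longrightarrow> M - mat_scale c N = 0"
  obtains c where "M = mat_scale c N"
proof -
  obtain N' where N': "N ** N' = mat 1"
    using N by (auto simp: invertible_def)
  obtain c w where w: "w \<noteq> 0" "(N' ** M) *v w = c *s w"
    by (rule eigenvector_exists[OF root])
  have "M *v w = N *v ((N' ** M) *v w)"
    by (simp add: matrix_vector_mul_assoc matrix_mul_assoc N')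
  also have "\<dots> = c *s (N *v w)"
    unfolding w(2) by (rule vector_scalar_commute)
  finally have "M *v w = c *s (N *v w)" .
  then have "(M - mat_scale c N) *v w = 0"
    by (simp add: matrix_vector_mult_diff_rdistrib mat_scale_matrix_vector_mult)
  from pencil[OF w(1) this] that[of c] show thesis
    by simp
qed

section \<open>Rank-one matrices in one class\<close>

definition outer :: "'k::semiring_1^'m \<Rightarrow> 'k^'n \<Rightarrow> 'k^'n^'m" where
  "outer u w = (\<chi> i j. u $ i * w $ j)"

lemma outer_factor:
  fixes u :: "'k::field^'n" and w w' :: "'k^'n"
  assumes "w \<noteq> 0"
  obtains Z where "outer u w' = outer u w ** Z"
proof -
  obtain i where i: "w $ i \<noteq> 0"
    using assms by (auto simp: vec_eq_iff)
  \<comment> \<open>The column \<open>axis i (1 / w $ i)\<close> is chosen to have scalar product 1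
    with \<open>w\<close>.\<close>
  have "outer u w' = outer u w ** outer (axis i (1 / w $ i)) w'"
    using i by (simp add: vec_eq_iff outer_def matrix_matrix_mult_def axis_def if_distrib
        if_distribR cong: if_cong)
  with that show thesis .
qed

lemma green_R_outer: "w \<noteq> 0 \<Longrightarrow> w' \<noteq> 0 \<Longrightarrow> green_R (outer u w) (outer u w')"
  unfolding green_R_def by (metis outer_factor)

section \<open>The matrices \<open>G_matrix T \<phi> u\<close> of a linear map\<close>

definition G_matrix :: "('k::field^'n^'n \<Rightarrow> 'k^'n^'n) \<Rightarrow> 'k^'n \<Rightarrow> 'k^'n \<Rightarrow> 'k^'n^'n" where
  "G_matrix T \<phi> u = (\<chi> k l. (\<phi> v* T (outer u (axis l 1))) $ k)"

context
  fixes T :: "'k::field^'n^'n \<Rightarrow> 'k^'n^'n"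
  assumes lin: "Vector_Spaces.linear mat_scale mat_scale T"
begin

interpretation T: Vector_Spaces.linear mat_scale mat_scale T
  by (rule lin)

lemma G_matrix_mult: "G_matrix T \<phi> u *v w = \<phi> v* T (outer u w)"
proof -
  have "outer u w = (\<Sum>l\<in>UNIV. mat_scale (w $ l) (outer u (axis l 1)))"
    by (simp add: vec_eq_iff outer_def axis_def if_distrib if_distribR mult.commute cong: if_cong)
  then have "T (outer u w) = (\<Sum>l\<in>UNIV. mat_scale (w $ l) (T (outer u (axis l 1))))"
    by (simp add: T.sum T.scale)
  then show ?thesis
    by (simp add: vec_eq_iff G_matrix_def matrix_vector_mult_def vector_matrix_mult_def
        sum_distrib_left sum_distrib_right mult_ac)
      (intro allI sum.swap)
qed

lemma G_matrix_diff_left: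
  "G_matrix T (\<phi> - c *s \<psi>) u = G_matrix T \<phi> u - mat_scale c (G_matrix T \<psi> u)"
  by (simp add: vec_eq_iff G_matrix_def vector_matrix_mult_def algebra_simps sum_subtractf
      sum_distrib_left)

lemma G_matrix_add_left: "G_matrix T (\<phi> + \<psi>) u = G_matrix T \<phi> u + G_matrix T \<psi> u"
  by (simp add: vec_eq_iff G_matrix_def vector_matrix_mult_def algebra_simps sum.distrib)

lemma G_matrix_diff_right:
  "G_matrix T \<phi> (u - c *s v) = G_matrix T \<phi> u - mat_scale c (G_matrix T \<phi> v)"
proof -
  have "outer (u - c *s v) w = outer u w - mat_scale c (outer v w)" for w :: "'k^'n"
    by (simp add: vec_eq_iff outer_def algebra_simps)
  then have eq: "T (outer (u - c *s v) w) = T (outer u w) - mat_scale c (T (outer v w))"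
    for w :: "'k^'n"
    by (simp add: T.diff T.scale)
  show ?thesis
    by (simp add: vec_eq_iff G_matrix_def eq vector_matrix_mult_def algebra_simps sum_subtractf
        sum_distrib_left)
qed

text \<open>Splitting \<open>A\<close> into its rows, each a rank-one matrix, shows that
  \<open>T\<close> is determined by the matrices G at unit vectors.\<close>

lemma row_eq_sum_G_matrix: "T A $ i = (\<Sum>j\<in>UNIV. G_matrix T (axis i 1) (axis j 1) *v (A $ j))"
proof -
  have "A = (\<Sum>j\<in>UNIV. outer (axis j 1) (A $ j))"
    by (simp add: vec_eq_iff outer_def axis_def if_distrib if_distribR cong: if_cong)
  then have "T A = (\<Sum>j\<in>UNIV. T (outer (axis j 1) (A $ j)))"
    by (metis T.sum)
  moreover have "axis i 1 v* M = M $ i" for M :: "'k^'n^'n"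
    by (simp add: vec_eq_iff vector_matrix_mult_def axis_def if_distrib if_distribR cong: if_cong)
  ultimately show ?thesis
    by (simp add: G_matrix_mult)
qed

section \<open>Linear maps that preserve the relation\<close>

context
  assumes pres: "preserves_R T"
begin

lemma G_matrix_zero_if_singular:
  assumes "w \<noteq> 0" "G_matrix T \<phi> u *v w = 0"
  shows "G_matrix T \<phi> u = 0"
proof -
  have "G_matrix T \<phi> u *v w' = 0" for w'
  proof (cases "w' = 0")
    case False
    with assms(1) have "green_R (T (outer u w)) (T (outer u w'))"
      using pres green_R_outer unfolding preserves_R_def by blast
    then obtain Y where "T (outer u w') = T (outer u w) ** Y"
      by (auto simp: green_R_def)
    \<comment> \<open>If \<phi> annihilates \<open>T (outer u w)\<close> from the left, it
      annihilates every right multiple of it.\<close>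
    then have "\<phi> v* T (outer u w') = (\<phi> v* T (outer u w)) v* Y"
      by (simp add: vector_matrix_mul_assoc)
    with assms(2) show ?thesis
      by (simp add: G_matrix_mult)
  qed simp
  then show ?thesis
    by (simp add: matrix_eq)
qed

lemma invertible_G_matrix: "G_matrix T \<phi> u \<noteq> 0 \<Longrightarrow> invertible (G_matrix T \<phi> u)"
  by (metis G_matrix_zero_if_singular invertible_left_inverse matrix_left_invertible_ker)

context
  assumes root: "\<And>p :: 'k poly. degree p = CARD('n) \<Longrightarrow> \<exists>x. poly p x = 0"
begin

lemma G_matrix_proportional_left:
  assumes "G_matrix T \<psi> u \<noteq> 0"
  obtains c where "G_matrix T \<phi> u = mat_scale c (G_matrix T \<psi> u)"
  using scalar_multiple_if_pencil_zero_or_injective[OF root invertible_G_matrix[OF assms]]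
    G_matrix_zero_if_singular G_matrix_diff_left by metis

lemma G_matrix_proportional_right:
  assumes "G_matrix T \<phi> v \<noteq> 0"
  obtains c where "G_matrix T \<phi> u = mat_scale c (G_matrix T \<phi> v)"
  using scalar_multiple_if_pencil_zero_or_injective[OF root invertible_G_matrix[OF assms]]
    G_matrix_zero_if_singular G_matrix_diff_right by metis

lemma G_matrix_proportional:
  assumes nz: "G_matrix T \<psi> v \<noteq> 0"
  obtains c where "G_matrix T \<phi> u = mat_scale c (G_matrix T \<psi> v)"
proof -
  have trans: "mat_scale a (mat_scale b L) = mat_scale (a * b) L" for a b and L :: "'k^'n^'n"
    by (simp add: vec_eq_iff)
  \<comment> \<open>A nonzero mixed matrix allows \<phi> and \<open>u\<close> to be changed one at a
    time.\<close>
  consider "G_matrix T \<psi> u \<noteq> 0" | "G_matrix T \<phi> v \<noteq> 0"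
    | "G_matrix T \<psi> u = 0" "G_matrix T \<phi> v = 0" by blast
  then show thesis
  proof cases
    case 1
    then show ?thesis
      using that trans G_matrix_proportional_left G_matrix_proportional_right nz by metis
  next
    case 2
    then show ?thesis
      using that trans G_matrix_proportional_left G_matrix_proportional_right nz by metis
  next
    case 3
    \<comment> \<open>The mixed terms vanish, so both matrices have the common row \<phi> + \<psi>
      and differ only in the column.\<close>
    then have "G_matrix T (\<phi> + \<psi>) u = G_matrix T \<phi> u" "G_matrix T (\<phi> + \<psi>) v = G_matrix T \<psi> v"
      by (simp_all add: G_matrix_add_left)
    then show ?thesis
      using that nz G_matrix_proportional_right by metis
  qed
qed

lemma preserves_R_imp_form: "\<exists>X P. invertible P \<and> T = (\<lambda>A. X ** A ** P)"
proof (cases "\<exists>\<psi> v. G_matrix T \<psi> v \<noteq> 0")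
  case False
  \<comment> \<open>Here \<open>T\<close> is zero, realised by \<open>X = 0\<close> and
    \<open>P = mat 1\<close>.\<close>
  then have "T A = 0 ** A ** mat 1" for A
    using False by (simp add: vec_eq_iff row_eq_sum_G_matrix matrix_vector_mult_def
        matrix_matrix_mult_def)
  moreover have "invertible (mat 1 :: 'k^'n^'n)"
    unfolding invertible_def using matrix_mul_lid by blast
  ultimately show ?thesis
    by blast
next
  case True
  then obtain \<psi> v where nz: "G_matrix T \<psi> v \<noteq> 0" by blast
  define L where "L = G_matrix T \<psi> v"
  have "\<forall>i j. \<exists>c. G_matrix T (axis i 1) (axis j 1) = mat_scale c L"
    unfolding L_def using G_matrix_proportional[OF nz] by metis
  then obtain x where x: "\<And>i j. G_matrix T (axis i 1) (axis j 1) = mat_scale (x i j) L"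
    by metis
  define X where "X = (\<chi> i j. x i j)"
  have "T A = X ** A ** transpose L" for A
  proof -
    have "T A $ i $ k = (\<Sum>j\<in>UNIV. \<Sum>l\<in>UNIV. X $ i $ j * A $ j $ l * L $ k $ l)" for i k
      by (simp add: row_eq_sum_G_matrix x X_def mat_scale_matrix_vector_mult matrix_vector_mult_def
          sum_distrib_left mult_ac)
    \<comment> \<open>\<open>L\<close> acts on the rows of \<open>A\<close> as column vectors, hence
      its transpose on the right.\<close>
    also have "\<dots> i k = (X ** A ** transpose L) $ i $ k" for i k
      by (subst sum.swap) (simp add: matrix_matrix_mult_def transpose_def sum_distrib_right)
    finally show ?thesis
      by (simp add: vec_eq_iff)
  qed
  moreover have "invertible (transpose L)"
    unfolding L_def using invertible_G_matrix[OF nz] by (simp add: invertible_det_nz)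
  ultimately show ?thesis
    by blast
qed

end
end
end

section \<open>The converse inclusion\<close>

lemma linear_mult_left_right:
  "Vector_Spaces.linear mat_scale mat_scale (\<lambda>A :: 'k::field^'n^'n. X ** A ** P)"
  unfolding Vector_Spaces.linear_iff
  by (simp add: vector_space_mat_scale vec_eq_iff matrix_matrix_mult_def sum.distrib
      sum_distrib_left sum_distrib_right algebra_simps)

lemma preserves_R_mult_left_right:
  fixes P :: "'k::field^'n^'n"
  assumes "invertible P"
  shows "preserves_R (\<lambda>A. X ** A ** P)"
proof -
  obtain Q where Q: "P ** Q = mat 1"
    using assms by (auto simp: invertible_def)
  \<comment> \<open>The right factor \<open>Y\<close> is replaced by its conjugate
    \<open>Q ** Y ** P\<close>, which supplies the new witnesses in both directions.\<close>
  have "X ** (B ** Y) ** P = X ** B ** P ** (Q ** Y ** P)" for B Y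
    by (metis Q matrix_mul_assoc matrix_mul_rid)
  then show ?thesis
    unfolding preserves_R_def green_R_def by metis
qed

theorem theorem3p17:
  assumes "\<And>p :: 'k::field poly. degree p = CARD('n::finite) \<Longrightarrow> \<exists>x. poly p x = 0"
  shows "{T :: 'k^'n^'n \<Rightarrow> 'k^'n^'n. Vector_Spaces.linear mat_scale mat_scale T \<and> preserves_R T}
       = {\<lambda>A. X ** A ** P | X P. invertible P}"
  using preserves_R_imp_form[OF _ _ assms] linear_mult_left_right preserves_R_mult_left_right
  by blast

end
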